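(* Given a finite undirected multigraph $H$, let $G$ be a graph isomorphic to the line graph $L(H)$. Let $\Delta$ denote the maximum degree $\Delta(G)$ of $G$ and let $\chi$ represent the chromatic number $\chi(G)$ of $G$. Then $$\mathrm{box}(G) \leq 2\Delta\left(\lceil \log_2 \log_2 \Delta \rceil + 3\right) + 1.$$
   Context: For a multigraph $H$ (parallel edges allowed), the line graph $L(H)$ is the simple graph whose vertices are the edges of $H$, where two distinct edges $e_1,e_2$ of $H$ are adjacent in $L(H)$ if and only if $e_1$ and $e_2$ share an endpoint in $H$. For a positive integer $k$, a $k$-box is a Cartesian product $R_1\times\cdots\times R_k\subseteq\mathbb{R}^k$ of closed intervals $R_i=[a_i,b_i]$. The boxicity $\mathrm{box}(G)$ of a finite simple graph $G$ is the minimum positive integer $k$ such that one can assign to each vertex of $G$ a $k$-box so that two distinct vertices are adjacent if and only if their boxes have non-empty intersection (in particular complete graphs have boxicity $1$). *)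

theory Defs
  imports Complex_Main "HOL-Library.FuncSet"
begin

text \<open>The set \<open>ends e\<close> consists of the endpoints of \<open>e\<close>. Distinct elements of \<open>edges H\<close> may have the
  same endpoints (parallel edges). An edge with a single endpoint is a loop; loops are permitted
  but need not occur.\<close>

record ('v, 'e) multigraph =
  vertices :: "'v set"
  edges :: "'e set"
  ends :: "'e \<Rightarrow> 'v set"

definition finite_multigraph :: "('v, 'e) multigraph \<Rightarrow> bool" where
  "finite_multigraph H \<longleftrightarrow>
     finite (vertices H) \<and> finite (edges H) \<and>
     (\<forall>e\<in>edges H. ends H e \<subseteq> vertices H \<and> card (ends H e) \<in> {1, 2})"

record 'a graph =
  verts :: "'a set"
  adj :: "'a \<Rightarrow> 'a \<Rightarrow> bool"

definition finite_simple_graph :: "'a graph \<Rightarrow> bool" where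
  "finite_simple_graph G \<longleftrightarrow>
     finite (verts G) \<and>
     (\<forall>u v. adj G u v \<longrightarrow> u \<in> verts G \<and> v \<in> verts G) \<and>
     (\<forall>u v. adj G u v \<longrightarrow> adj G v u) \<and>
     (\<forall>v. \<not> adj G v v)"

definition graph_isomorphic :: "'a graph \<Rightarrow> 'b graph \<Rightarrow> bool" where
  "graph_isomorphic G G' \<longleftrightarrow>
     (\<exists>f. bij_betw f (verts G) (verts G') \<and>
          (\<forall>u\<in>verts G. \<forall>v\<in>verts G. adj G u v \<longleftrightarrow> adj G' (f u) (f v)))"

definition line_graph :: "('v, 'e) multigraph \<Rightarrow> 'e graph" where
  "line_graph H =
     \<lparr>verts = edges H,
      adj = (\<lambda>e e'. e \<in> edges H \<and> e' \<in> edges H \<and> e \<noteq> e' \<and> ends H e \<inter> ends H e' \<noteq> {})\<rparr>"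

definition degree :: "'a graph \<Rightarrow> 'a \<Rightarrow> nat" where
  "degree G v = card {u \<in> verts G. adj G v u}"

text \<open>Inserting \<open>0\<close> only matters for the graph without vertices, whose maximum degree is thereby
  \<open>0\<close>.\<close>

definition max_degree :: "'a graph \<Rightarrow> nat" where
  "max_degree G = Max (insert 0 (degree G ` verts G))"

text \<open>Points of \<open>k\<close>-dimensional real space are extensional functions on \<open>{..<k}\<close>, so that \<open>k\<close> can
  vary inside a formula.\<close>

definition is_box :: "nat \<Rightarrow> (nat \<Rightarrow> real) set \<Rightarrow> bool" where
  "is_box k B \<longleftrightarrow>
     (\<exists>a b. (\<forall>i<k. a i \<le> b i) \<and> B = (\<Pi>\<^sub>E i\<in>{..<k}. {a i..b i}))"

definition box_representation :: "nat \<Rightarrow> 'a graph \<Rightarrow> ('a \<Rightarrow> (nat \<Rightarrow> real) set) \<Rightarrow> bool" where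
  "box_representation k G B \<longleftrightarrow>
     (\<forall>v\<in>verts G. is_box k (B v)) \<and>
     (\<forall>u\<in>verts G. \<forall>v\<in>verts G. u \<noteq> v \<longrightarrow> (adj G u v \<longleftrightarrow> B u \<inter> B v \<noteq> {}))"

definition boxicity :: "'a graph \<Rightarrow> nat" where
  "boxicity G = (LEAST k. k > 0 \<and> (\<exists>B. box_representation k G B))"

lemma finite_simple_graph_line_graph:
  "finite_multigraph H \<Longrightarrow> finite_simple_graph (line_graph H)"
  by (auto simp: finite_multigraph_def finite_simple_graph_def line_graph_def)

text \<open>The minimum in the definition of \<open>boxicity\<close> is attained for every finite simple graph.\<close>

lemma box_representation_exists:
  assumes "finite_simple_graph G"
  shows "\<exists>k>0. \<exists>B. box_representation k G B"
proof -
  have fin: "finite (verts G)" and sym: "\<And>u v. adj G u v \<Longrightarrow> adj G v u"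
    using assms by (auto simp: finite_simple_graph_def)
  obtain x where x: "bij_betw x {..<card (verts G)} (verts G)"
    using ex_bij_betw_nat_finite[OF fin] by (auto simp: atLeast0LessThan)
  define k where "k = Suc (card (verts G))"
  define a where "a v i = (if v = x i \<or> adj G (x i) v \<or> i = card (verts G) then 0 else 1 :: real)"
    for v i
  define b where "b v i = (if v = x i \<or> i = card (verts G) then 0 else 1 :: real)" for v i
  define B where "B v = (\<Pi>\<^sub>E i\<in>{..<k}. {a v i..b v i})" for v
  have ab: "a v i \<le> b v i" for v i by (auto simp: a_def b_def)
  have "adj G u v \<longleftrightarrow> B u \<inter> B v \<noteq> {}"
    if u: "u \<in> verts G" and v: "v \<in> verts G" and uv: "u \<noteq> v" for u v
  proof
    assume "adj G u v"
    then have "(\<lambda>i\<in>{..<k}. max (a u i) (a v i)) \<in> B u \<inter> B v"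
      using uv sym by (auto simp: B_def a_def b_def)
    then show "B u \<inter> B v \<noteq> {}" by blast
  next
    assume "B u \<inter> B v \<noteq> {}"
    then obtain p where p: "p \<in> B u" "p \<in> B v" by blast
    obtain i where i: "i < card (verts G)" "x i = u"
      using x u by (force simp: bij_betw_def)
    have "p i \<in> {a u i..b u i}" "p i \<in> {a v i..b v i}"
      using p i by (auto simp: B_def k_def PiE_def Pi_def)
    then show "adj G u v"
      using i uv by (auto simp: a_def b_def split: if_splits)
  qed
  moreover have "is_box k (B v)" for v
    unfolding is_box_def B_def using ab by blast
  ultimately have "box_representation k G B"
    by (simp add: box_representation_def)
  then show ?thesis by (auto simp: k_def)
qed

end

theory Submission
  imports Defs
begin

text \<open>Line graphs are claw-free: a vertex has at most two neighbours in an independent set. Colour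
  \<open>G\<close> greedily with \<open>\<Delta> + 1\<close> colours and let \<open>C\<close> be one of the first \<open>\<Delta>\<close> colour classes. Given a linear
  order on \<open>C\<close>, represent the members of \<open>C\<close> by distinct points and every other vertex by the ray
  (to the right, or to the left) that starts at its first (last) neighbour in \<open>C\<close>. The rays meet
  pairwise, and a member \<open>y\<close> of \<open>C\<close> is separated from a non-neighbour whose neighbours in \<open>C\<close> are
  \<open>x\<close> and \<open>z\<close> if \<open>y\<close> does not lie between \<open>x\<close> and \<open>z\<close>. Hence we need few orders on \<open>C\<close> such that
  for all such triples \<open>y\<close> is not between \<open>x\<close> and \<open>z\<close> in one of them. Squaring a ground set costs one
  more order (lexicographic products), so \<open>r + 1\<close> orders suffice for \<open>2^2^r\<close> points. Two neighbours
  of a common vertex can be given different labels out of \<open>\<Delta> + 1 \<le> 2^2^(k + 1)\<close> many, where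
  \<open>k = \<lceil>log 2 (log 2 \<Delta>)\<rceil>\<close>, and one further order breaks ties between equal labels; so \<open>k + 3\<close> orders
  suffice. One last interval graph separates the members of the remaining colour class.\<close>

section \<open>Greedy colouring\<close>

text \<open>Induction on \<open>V\<close>: the added vertex has at most \<open>d\<close> neighbours
  among the earlier ones, so one of the \<open>d + 1\<close> colours up to \<open>d\<close> is free.
  This colours \<open>G\<close> itself and, with a conflict relation in place of adjacency, labels
  the members of each colour class.\<close>

lemma greedy_colouring:
  assumes "finite V" "\<And>u v. R u v \<Longrightarrow> R v u" "\<And>v. v \<in> V \<Longrightarrow> card {u \<in> V. R v u} \<le> d"
  shows "\<exists>col :: 'a \<Rightarrow> nat. (\<forall>v\<in>V. col v \<le> d) \<and> (\<forall>u\<in>V. \<forall>v\<in>V. R u v \<and> u \<noteq> v \<longrightarrow> col u \<noteq> col v)"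
  using assms(1,3)
proof (induction V rule: finite_induct)
  case empty
  then show ?case by simp
next
  case (insert w F)
  have "card {u \<in> F. R v u} \<le> d" if "v \<in> F" for v
  proof -
    have "card {u \<in> F. R v u} \<le> card {u \<in> insert w F. R v u}"
      using insert.hyps by (intro card_mono) auto
    also have "\<dots> \<le> d" using insert.prems that by simp
    finally show ?thesis .
  qed
  then obtain col :: "'a \<Rightarrow> nat" where col: "\<And>v. v \<in> F \<Longrightarrow> col v \<le> d"
    "\<And>u v. u \<in> F \<Longrightarrow> v \<in> F \<Longrightarrow> R u v \<Longrightarrow> u \<noteq> v \<Longrightarrow> col u \<noteq> col v"
    using insert.IH by blast
  have "card (col ` {u \<in> F. R w u}) \<le> card {u \<in> insert w F. R w u}"
    using insert.hyps by (intro order_trans[OF card_image_le] card_mono) auto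
  also have "\<dots> < card {..d}" using insert.prems[of w] by simp
  finally have "\<not> {..d} \<subseteq> col ` {u \<in> F. R w u}"
    using card_mono[of "col ` {u \<in> F. R w u}" "{..d}"] insert.hyps by auto
  then obtain c where c: "c \<le> d" "c \<notin> col ` {u \<in> F. R w u}" by auto
  then have "c \<noteq> col u" if "u \<in> F" "R w u \<or> R u w" for u using that assms(2) by blast
  then have "(\<forall>v\<in>insert w F. (col(w := c)) v \<le> d) \<and>
    (\<forall>u\<in>insert w F. \<forall>v\<in>insert w F. R u v \<and> u \<noteq> v \<longrightarrow> (col(w := c)) u \<noteq> (col(w := c)) v)"
    using c(1) col insert.hyps by auto
  then show ?case by blast
qed

section \<open>Linear orders avoiding betweenness\<close>

text \<open>Linear orders are given by injections into the natural numbers.\<close>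

definition not_between :: "('a \<Rightarrow> nat) \<Rightarrow> 'a \<Rightarrow> 'a \<Rightarrow> 'a \<Rightarrow> bool" where
  "not_between p x y z \<longleftrightarrow> p y < p x \<and> p y < p z \<or> p x < p y \<and> p z < p y"

text \<open>\<open>a * N + q\<close> with \<open>q < N\<close> is the base-\<open>N\<close> encoding
  of a pair whose first component dominates.\<close>

lemma lex_less:
  fixes a b q q' N :: nat
  assumes "a < b" "q < N"
  shows "a * N + q < b * N + q'"
proof -
  have "a * N + q < Suc a * N" using assms by simp
  also have "\<dots> \<le> b * N" using assms by (intro mult_right_mono) auto
  finally show ?thesis by simp
qed

lemma not_between_lex:
  assumes "q x < N" "q y < N" "q z < N" "not_between p x y z"
  shows "not_between (\<lambda>v. p v * N + q v) x y z"
  using assms lex_less[of _ _ _ N] unfolding not_between_def by blast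

lemma inj_on_lex:
  fixes p q :: "'a \<Rightarrow> nat"
  assumes "\<And>x. x \<in> C \<Longrightarrow> q x < N"
    and "\<And>x y. x \<in> C \<Longrightarrow> y \<in> C \<Longrightarrow> p x = p y \<Longrightarrow> q x = q y \<Longrightarrow> x = y"
  shows "inj_on (\<lambda>v. p v * N + q v) C"
proof (rule inj_onI)
  fix x y assume *: "x \<in> C" "y \<in> C" "p x * N + q x = p y * N + q y"
  then have "p x = p y"
    using lex_less[of "p x" "p y" "q x" N "q y"] lex_less[of "p y" "p x" "q y" N "q x"] assms(1)
    by (metis less_irrefl linorder_neqE_nat)
  with * assms(2) show "x = y" by simp
qed

text \<open>The new order with index \<open>m\<close> reverses the second component, so that together with the order of
  index \<open>0\<close> it settles the triples in which exactly two of the first components agree.\<close>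

lemma lexicographic_orders:
  fixes p q :: "nat \<Rightarrow> 'a \<Rightarrow> nat"
  assumes m: "m > 0"
    and q: "\<And>j x. j < m \<Longrightarrow> x \<in> C \<Longrightarrow> q j x < N"
    and p: "\<And>j x. j < m \<Longrightarrow> x \<in> C \<Longrightarrow> p j x < n"
    and p_fibre: "\<And>j x y. j < m \<Longrightarrow> x \<in> C \<Longrightarrow> y \<in> C \<Longrightarrow> p j x = p j y \<longleftrightarrow> f x = f y"
    and q_inj: "\<And>j x y. j < m \<Longrightarrow> x \<in> C \<Longrightarrow> y \<in> C \<Longrightarrow> f x = f y \<Longrightarrow> q j x = q j y \<Longrightarrow> x = y"
  obtains s :: "nat \<Rightarrow> 'a \<Rightarrow> nat" where
    "\<forall>j<Suc m. inj_on (s j) C"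
    "\<forall>j<Suc m. \<forall>x\<in>C. s j x < n * N"
    "\<forall>x\<in>C. \<forall>y\<in>C. \<forall>z\<in>C. y \<noteq> x \<longrightarrow> y \<noteq> z \<longrightarrow>
      (f x \<noteq> f y \<longrightarrow> f y \<noteq> f z \<longrightarrow> f x \<noteq> f z \<longrightarrow>
        (\<exists>j<m. not_between (p j) x y z)) \<longrightarrow>
      (f x = f y \<longrightarrow> f y = f z \<longrightarrow> (\<exists>j<m. not_between (q j) x y z)) \<longrightarrow>
      (\<exists>j<Suc m. not_between (s j) x y z)"
proof -
  \<comment> \<open>\<open>N - 1 - q 0 v\<close> reverses \<open>q 0\<close> within the range below
    \<open>N\<close>, so it can again serve as a digit.\<close>
  define s where "s j v = (if j < m then p j v * N + q j v else p 0 v * N + (N - 1 - q 0 v))" for j v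
  have bound: "s j x < n * N" if "x \<in> C" for j x
  proof (cases "j < m")
    case True
    then show ?thesis using lex_less[of "p j x" n "q j x" N 0] p q that by (simp add: s_def)
  next
    case False
    then show ?thesis
      using lex_less[of "p 0 x" n "N - 1 - q 0 x" N 0] p[OF m that] q[OF m that] by (simp add: s_def)
  qed
  have inj: "inj_on (s j) C" for j
  proof (cases "j < m")
    case True
    then have "inj_on (\<lambda>v. p j v * N + q j v) C"
      by (intro inj_on_lex) (use q p_fibre q_inj in blast)+
    with True show ?thesis by (simp add: s_def[abs_def])
  next
    case False
    have "inj_on (\<lambda>v. p 0 v * N + (N - 1 - q 0 v)) C"
    proof (rule inj_on_lex)
      show "N - 1 - q 0 x < N" if "x \<in> C" for x using q[OF m that] by simp
      fix x y assume *: "x \<in> C" "y \<in> C" "p 0 x = p 0 y" "N - 1 - q 0 x = N - 1 - q 0 y"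
      then have "q 0 x = q 0 y" using q[OF m, of x] q[OF m, of y] by simp
      then show "x = y" using * p_fibre[OF m] q_inj[OF m] by blast
    qed
    with False show ?thesis by (simp add: s_def[abs_def])
  qed
  \<comment> \<open>In \<open>s 0\<close> and \<open>s m\<close> alike, \<open>p 0\<close> puts
    \<open>z\<close> on one and the same side of both \<open>x\<close> and \<open>y\<close>. The
    order of \<open>x\<close> and \<open>y\<close> is opposite in the two, so in one of them
    \<open>y\<close> is the farther from \<open>z\<close>.\<close>
  have tie: "\<exists>j<Suc m. not_between (s j) x y z"
    if xyz: "x \<in> C" "y \<in> C" "z \<in> C" and ne: "y \<noteq> x" and f: "f x = f y" "f y \<noteq> f z" for x y z
  proof -
    have pe: "p 0 x = p 0 y" and pn: "p 0 y \<noteq> p 0 z" using p_fibre[OF m] xyz f by auto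
    have qn: "q 0 x \<noteq> q 0 y" using q_inj[OF m] xyz f ne by blast
    have qN: "q 0 x < N" "q 0 y < N" "q 0 z < N" using q[OF m] xyz by auto
    have "p 0 y * N + a < p 0 z * N + b \<longleftrightarrow> p 0 y < p 0 z" 
         "p 0 z * N + b < p 0 y * N + a \<longleftrightarrow> p 0 z < p 0 y" if "a < N" "b < N" for a b
      using lex_less[of "p 0 y" "p 0 z" a N b] lex_less[of "p 0 z" "p 0 y" b N a] that pn
      by (meson less_asym linorder_neqE_nat)+
    note side = this
    define q' where "q' v = N - 1 - q 0 v" for v
    have q': "q' x < N" "q' y < N" "q' z < N" "q' x < q' y \<longleftrightarrow> q 0 y < q 0 x"
      "q' y < q' x \<longleftrightarrow> q 0 x < q 0 y"
      using qN unfolding q'_def by auto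
    have s0: "s 0 v = p 0 v * N + q 0 v" and sm: "s m v = p 0 v * N + q' v" for v
      using m by (simp_all add: s_def q'_def)
    have "not_between (s 0) x y z \<or> not_between (s m) x y z"
      unfolding not_between_def s0 sm pe using side[OF qN(2,3)] side[OF q'(2,3)] q'(4,5) pn qn by auto
    then show ?thesis using lessI zero_less_Suc by blast
  qed
  have sep: "\<exists>j<Suc m. not_between (s j) x y z"
    if xyz: "x \<in> C" "y \<in> C" "z \<in> C" and ne: "y \<noteq> x" "y \<noteq> z"
      and d: "f x \<noteq> f y \<Longrightarrow> f y \<noteq> f z \<Longrightarrow> f x \<noteq> f z \<Longrightarrow> \<exists>j<m. not_between (p j) x y z"
      and e: "f x = f y \<Longrightarrow> f y = f z \<Longrightarrow> \<exists>j<m. not_between (q j) x y z" for x y z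
  proof -
    \<comment> \<open>The cases list which values of \<open>f\<close> coincide. Case 4 is case 3
      with \<open>x\<close> and \<open>z\<close> exchanged; in case 5 already \<open>p 0\<close>
      puts \<open>y\<close> outside the block that holds \<open>x\<close> and
      \<open>z\<close>.\<close>
    consider "f x \<noteq> f y \<and> f y \<noteq> f z \<and> f x \<noteq> f z" | "f x = f y \<and> f y = f z"
      | "f x = f y" "f y \<noteq> f z" | "f z = f y" "f y \<noteq> f x" | "f x = f z" "f y \<noteq> f x" by metis
    then show ?thesis
    proof cases
      case 1
      then obtain j where j: "j < m" "not_between (p j) x y z" using d by blast
      then have "not_between (s j) x y z"
        using not_between_lex[of "q j" x N y z "p j"] q xyz by (simp add: s_def[abs_def])
      then show ?thesis using j less_SucI by blast
    next
      case 2
      then obtain j where j: "j < m" "not_between (q j) x y z" using e by blast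
      then have "p j x = p j y" "p j y = p j z" using p_fibre xyz 2 by auto
      then have "not_between (s j) x y z" using j by (simp add: not_between_def s_def)
      then show ?thesis using j less_SucI by blast
    next
      case 3
      then show ?thesis using tie xyz ne by blast
    next
      case 4
      then have "\<exists>j<Suc m. not_between (s j) z y x" using tie xyz ne by blast
      then show ?thesis unfolding not_between_def by blast
    next
      case 5
      then have "p 0 x = p 0 z" "p 0 y \<noteq> p 0 x" using p_fibre[OF m] xyz by auto
      then have "not_between (p 0) x y z" by (auto simp: not_between_def)
      then have "not_between (s 0) x y z"
        using not_between_lex[of "q 0" x N y z "p 0"] q xyz m by (simp add: s_def[abs_def])
      then show ?thesis by blast
    qed
  qed
  show thesis
  proof (rule that)
    show "\<forall>j<Suc m. inj_on (s j) C" using inj by blast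
    show "\<forall>j<Suc m. \<forall>x\<in>C. s j x < n * N" using bound by blast
  qed (intro ballI impI sep; blast)
qed

section \<open>Few orders for doubly exponentially many points\<close>

text \<open>A number below \<open>n * n\<close> is the pair of its quotient and remainder by
  \<open>n\<close>. Keeping the values of \<open>p j\<close> below \<open>2^2^r\<close> lets these
  orders serve as digits in the next squaring.\<close>

lemma orders_on_double_power:
  "\<exists>p :: nat \<Rightarrow> nat \<Rightarrow> nat. (\<forall>j<Suc r. inj_on (p j) {..<2^2^r} \<and> (\<forall>x<2^2^r. p j x < 2^2^r)) \<and>
    (\<forall>x<2^2^r. \<forall>y<2^2^r. \<forall>z<2^2^r. x \<noteq> y \<and> y \<noteq> z \<and> x \<noteq> z \<longrightarrow>
      (\<exists>j<Suc r. not_between (p j) x y z))"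
proof (induction r)
  case 0
  \<comment> \<open>Two points contain no three distinct ones, so a single order will do.\<close>
  show ?case by (rule exI[of _ "\<lambda>_. id"]) auto
next
  case (Suc r)
  define n :: nat where "n = 2^2^r"
  have n: "n > 0" by (simp add: n_def)
  have nn: "2^2^Suc r = n * n" by (simp add: n_def mult_2 power_add)
  obtain p :: "nat \<Rightarrow> nat \<Rightarrow> nat" where
    inj: "\<And>j. j < Suc r \<Longrightarrow> inj_on (p j) {..<n}" and bound: "\<And>j x. j < Suc r \<Longrightarrow> x < n \<Longrightarrow> p j x < n"
    and sep: "\<And>x y z. x < n \<Longrightarrow> y < n \<Longrightarrow> z < n \<Longrightarrow> x \<noteq> y \<Longrightarrow> y \<noteq> z \<Longrightarrow> x \<noteq> z \<Longrightarrow>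
      \<exists>j<Suc r. not_between (p j) x y z"
    using Suc.IH unfolding n_def by metis
  have dv: "x div n < n" if "x < n * n" for x using that by (simp add: less_mult_imp_div_less)
  have inj': "p j x = p j y \<longleftrightarrow> x = y" if "j < Suc r" "x < n" "y < n" for j x y
    using inj[OF that(1)] that by (auto simp: inj_on_def)
  have eqI: "x = y" if "x div n = y div n" "x mod n = y mod n" for x y
    using that by (metis div_mult_mod_eq)
  obtain s :: "nat \<Rightarrow> nat \<Rightarrow> nat" where
    s_inj: "\<forall>j<Suc (Suc r). inj_on (s j) {..<n * n}" and
    s_less: "\<forall>j<Suc (Suc r). \<forall>x\<in>{..<n * n}. s j x < n * n" and
    s_sep: "\<forall>x\<in>{..<n * n}. \<forall>y\<in>{..<n * n}. \<forall>z\<in>{..<n * n}. y \<noteq> x \<longrightarrow> y \<noteq> z \<longrightarrow>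
      (x div n \<noteq> y div n \<longrightarrow> y div n \<noteq> z div n \<longrightarrow> x div n \<noteq> z div n \<longrightarrow>
        (\<exists>j<Suc r. not_between (\<lambda>x. p j (x div n)) x y z)) \<longrightarrow>
      (x div n = y div n \<longrightarrow> y div n = z div n \<longrightarrow> (\<exists>j<Suc r. not_between (\<lambda>x. p j (x mod n)) x y z)) \<longrightarrow>
      (\<exists>j<Suc (Suc r). not_between (s j) x y z)"
  proof (rule lexicographic_orders[where m = "Suc r" and C = "{..<n * n}" and N = n and n = n
        and f = "\<lambda>x. x div n" and p = "\<lambda>j x. p j (x div n)" and q = "\<lambda>j x. p j (x mod n)"])
    show "p j (x mod n) < n" if "j < Suc r" for j x using bound that n by simp
    show "p j (x div n) < n" if "j < Suc r" "x \<in> {..<n * n}" for j x using bound dv that by simp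
    show "p j (x div n) = p j (y div n) \<longleftrightarrow> x div n = y div n"
      if "j < Suc r" "x \<in> {..<n * n}" "y \<in> {..<n * n}" for j x y using inj' dv that by simp
    show "x = y" if "j < Suc r" "x div n = y div n" "p j (x mod n) = p j (y mod n)" for j x y
      using inj'[of j "x mod n" "y mod n"] n that by (metis eqI mod_less_divisor)
  qed (simp, rule that)
  have "\<exists>j<Suc (Suc r). not_between (s j) x y z"
    if xyz: "x < n * n" "y < n * n" "z < n * n" and ne: "x \<noteq> y" "y \<noteq> z" "x \<noteq> z" for x y z
  proof (rule s_sep[rule_format])
    assume "x div n \<noteq> y div n" "y div n \<noteq> z div n" "x div n \<noteq> z div n"
    then show "\<exists>j<Suc r. not_between (\<lambda>x. p j (x div n)) x y z"
      using sep[of "x div n" "y div n" "z div n"] dv xyz by (simp add: not_between_def)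
  next
    assume "x div n = y div n" "y div n = z div n"
    then have "x mod n \<noteq> y mod n" "y mod n \<noteq> z mod n" "x mod n \<noteq> z mod n" using eqI ne by metis+
    then show "\<exists>j<Suc r. not_between (\<lambda>x. p j (x mod n)) x y z"
      using sep[of "x mod n" "y mod n" "z mod n"] n by (simp add: not_between_def)
  qed (use xyz ne in auto)
  with s_inj s_less show ?case unfolding nn by (intro exI[of _ s]) (simp add: Ball_def)
qed

text \<open>The label is the leading component, and one enumeration \<open>i\<close> of
  \<open>C\<close> breaks ties in all orders. A single \<open>i\<close> suffices:
  \<open>lab x \<noteq> lab z\<close> excludes three equal labels, and for \<open>x = z\<close> any
  order has \<open>y\<close> on one side.\<close>

lemma orders_separating_labels:
  fixes lab :: "'a \<Rightarrow> nat"
  assumes "finite C" and lab: "\<And>x. x \<in> C \<Longrightarrow> lab x < 2^2^r"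
  shows "\<exists>(s :: nat \<Rightarrow> 'a \<Rightarrow> nat) M. (\<forall>j<r + 2. inj_on (s j) C \<and> (\<forall>x\<in>C. s j x < M)) \<and>
    (\<forall>x\<in>C. \<forall>y\<in>C. \<forall>z\<in>C. y \<noteq> x \<and> y \<noteq> z \<and> (x = z \<or> lab x \<noteq> lab z) \<longrightarrow>
      (\<exists>j<r + 2. not_between (s j) x y z))"
proof -
  obtain p :: "nat \<Rightarrow> nat \<Rightarrow> nat" where
    p: "\<And>j. j < Suc r \<Longrightarrow> inj_on (p j) {..<2^2^r}" "\<And>j x. j < Suc r \<Longrightarrow> x < 2^2^r \<Longrightarrow> p j x < 2^2^r"
    and sep: "\<And>x y z. x < 2^2^r \<Longrightarrow> y < 2^2^r \<Longrightarrow> z < 2^2^r \<Longrightarrow> x \<noteq> y \<Longrightarrow> y \<noteq> z \<Longrightarrow> x \<noteq> z \<Longrightarrow>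
      \<exists>j<Suc r. not_between (p j) x y z"
    using orders_on_double_power[of r] by metis
  obtain i :: "'a \<Rightarrow> nat" and N where i: "i ` C = {..<N}" "inj_on i C"
    using finite_imp_inj_to_nat_seg[OF assms(1)] by (auto simp: lessThan_def)
  have pl: "p j (lab x) = p j (lab y) \<longleftrightarrow> lab x = lab y" if "j < Suc r" "x \<in> C" "y \<in> C" for j x y
    using p(1)[OF that(1)] lab that by (auto simp: inj_on_def)
  obtain s :: "nat \<Rightarrow> 'a \<Rightarrow> nat" where
    s_inj: "\<forall>j<Suc (Suc r). inj_on (s j) C" and
    s_less: "\<forall>j<Suc (Suc r). \<forall>x\<in>C. s j x < 2^2^r * N" and
    s_sep: "\<forall>x\<in>C. \<forall>y\<in>C. \<forall>z\<in>C. y \<noteq> x \<longrightarrow> y \<noteq> z \<longrightarrow>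
      (lab x \<noteq> lab y \<longrightarrow> lab y \<noteq> lab z \<longrightarrow> lab x \<noteq> lab z \<longrightarrow>
        (\<exists>j<Suc r. not_between (\<lambda>x. p j (lab x)) x y z)) \<longrightarrow>
      (lab x = lab y \<longrightarrow> lab y = lab z \<longrightarrow> (\<exists>j<Suc r. not_between i x y z)) \<longrightarrow>
      (\<exists>j<Suc (Suc r). not_between (s j) x y z)"
  proof (rule lexicographic_orders[where m = "Suc r" and C = C and N = N and n = "2^2^r"
        and f = lab and p = "\<lambda>j x. p j (lab x)" and q = "\<lambda>_. i"])
    show "i x < N" if "x \<in> C" for x using i(1) that by auto
    show "p j (lab x) < 2^2^r" if "j < Suc r" "x \<in> C" for j x using p(2) lab that by blast
    show "p j (lab x) = p j (lab y) \<longleftrightarrow> lab x = lab y"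
      if "j < Suc r" "x \<in> C" "y \<in> C" for j x y using pl that by blast
    show "x = y" if "x \<in> C" "y \<in> C" "i x = i y" for x y using i(2) that by (auto simp: inj_on_def)
  qed (simp, rule that)
  have "\<exists>j<Suc (Suc r). not_between (s j) x y z"
    if xyz: "x \<in> C" "y \<in> C" "z \<in> C" and ne: "y \<noteq> x" "y \<noteq> z" and l: "x = z \<or> lab x \<noteq> lab z" for x y z
  proof (cases "x = z")
    case True
    have "s 0 x \<noteq> s 0 y" using s_inj xyz ne by (auto simp: inj_on_def)
    then have "not_between (s 0) x y z" using True by (auto simp: not_between_def)
    then show ?thesis by blast
  next
    case False
    show ?thesis
    proof (rule s_sep[rule_format])
      assume "lab x \<noteq> lab y" "lab y \<noteq> lab z" "lab x \<noteq> lab z"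
      then show "\<exists>j<Suc r. not_between (\<lambda>x. p j (lab x)) x y z"
        using sep[of "lab x" "lab y" "lab z"] lab xyz by (simp add: not_between_def)
    qed (use xyz ne l False in auto)
  qed
  with s_inj s_less show ?thesis by (intro exI[of _ s] exI[of _ "2^2^r * N"]) simp
qed

section \<open>Boxicity of claw-free graphs\<close>

text \<open>Boxes meet iff their projections overlap in every coordinate. The arbitrary index set
  \<open>I\<close> allows coordinates to be named by colour class, order and direction.\<close>

lemma boxicity_le_card:
  fixes a b :: "'i \<Rightarrow> 'a \<Rightarrow> real"
  assumes I: "finite I" "I \<noteq> {}"
    and ab: "\<And>i v. i \<in> I \<Longrightarrow> v \<in> verts G \<Longrightarrow> a i v \<le> b i v"
    and adj: "\<And>u v. u \<in> verts G \<Longrightarrow> v \<in> verts G \<Longrightarrow> u \<noteq> v \<Longrightarrow>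
      adj G u v \<longleftrightarrow> (\<forall>i\<in>I. a i u \<le> b i v \<and> a i v \<le> b i u)"
  shows "boxicity G \<le> card I"
proof -
  obtain g where g: "bij_betw g {..<card I} I"
    using ex_bij_betw_nat_finite[OF I(1)] by (auto simp: atLeast0LessThan)
  then have gI: "g i \<in> I" if "i < card I" for i using that by (auto simp: bij_betw_def)
  define B where "B v = (\<Pi>\<^sub>E i\<in>{..<card I}. {a (g i) v..b (g i) v})" for v
  have "adj G u v \<longleftrightarrow> B u \<inter> B v \<noteq> {}" if uv: "u \<in> verts G" "v \<in> verts G" "u \<noteq> v" for u v
  proof
    assume "adj G u v"
    then have "(\<lambda>i\<in>{..<card I}. max (a (g i) u) (a (g i) v)) \<in> B u \<inter> B v"
      using uv adj gI ab by (auto simp: B_def)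
    then show "B u \<inter> B v \<noteq> {}" by blast
  next
    assume "B u \<inter> B v \<noteq> {}"
    then obtain x where x: "x \<in> B u" "x \<in> B v" by blast
    have "a i u \<le> b i v \<and> a i v \<le> b i u" if i: "i \<in> I" for i
    proof -
      obtain j where j: "j < card I" "g j = i" using g i unfolding bij_betw_def by (metis imageE lessThan_iff)
      have "x j \<in> {a i u..b i u}" "x j \<in> {a i v..b i v}" using x j by (auto simp: B_def PiE_def Pi_def)
      then show ?thesis by auto
    qed
    then show "adj G u v" using adj uv by blast
  qed
  moreover have "is_box (card I) (B v)" if "v \<in> verts G" for v
    unfolding is_box_def B_def
    by (intro exI[of _ "\<lambda>i. a (g i) v"] exI[of _ "\<lambda>i. b (g i) v"]) (use that gI ab in auto)
  ultimately have "box_representation (card I) G B" by (simp add: box_representation_def)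
  moreover have "card I > 0" using I by (simp add: card_gt_0_iff)
  ultimately show ?thesis unfolding boxicity_def by (intro Least_le) blast
qed

section \<open>Claw-freeness of line graphs\<close>

text \<open>For finite simple graphs this excludes an induced star with three leaves. The
  cardinality form applies directly to the neighbours of \<open>v\<close> in a colour class.\<close>

definition claw_free :: "'a graph \<Rightarrow> bool" where
  "claw_free G \<longleftrightarrow> (\<forall>v\<in>verts G. \<forall>S\<subseteq>{u \<in> verts G. adj G v u}.
     (\<forall>x\<in>S. \<forall>y\<in>S. \<not> adj G x y) \<longrightarrow> card S \<le> 2)"

text \<open>Pairwise disjoint edges that meet a given edge do so in different endpoints of it, and
  there are at most two of these: the choice \<open>g\<close> of a shared endpoint is
  injective.\<close>

lemma claw_free_line_graph:
  assumes "finite_multigraph H" and iso: "graph_isomorphic G (line_graph H)"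
  shows "claw_free G"
  unfolding claw_free_def
proof (intro ballI allI impI)
  fix v S assume v: "v \<in> verts G" and S: "S \<subseteq> {u \<in> verts G. adj G v u}"
    and ind: "\<forall>x\<in>S. \<forall>y\<in>S. \<not> adj G x y"
  obtain f where f: "bij_betw f (verts G) (edges H)" and adj: "\<And>x y. x \<in> verts G \<Longrightarrow> y \<in> verts G \<Longrightarrow>
      adj G x y \<longleftrightarrow> adj (line_graph H) (f x) (f y)"
    using iso by (auto simp: graph_isomorphic_def line_graph_def)
  have "f v \<in> edges H" using f v by (auto simp: bij_betw_def)
  then have "card (ends H (f v)) \<in> {1, 2}" using assms(1) by (simp add: finite_multigraph_def)
  then have fin: "finite (ends H (f v)) \<and> card (ends H (f v)) \<le> 2" by (auto intro: card_ge_0_finite)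
  have "\<exists>e. e \<in> ends H (f v) \<inter> ends H (f x)" if "x \<in> S" for x
  proof -
    have "adj (line_graph H) (f v) (f x)" using that S adj v by blast
    then show ?thesis by (auto simp: line_graph_def)
  qed
  then obtain g where g: "\<And>x. x \<in> S \<Longrightarrow> g x \<in> ends H (f v) \<inter> ends H (f x)" by metis
  have "inj_on g S"
  proof (rule inj_onI)
    fix x y assume xy: "x \<in> S" "y \<in> S" "g x = g y"
    have V: "x \<in> verts G" "y \<in> verts G" using xy S by auto
    have "\<not> adj (line_graph H) (f x) (f y)" using ind xy V adj by blast
    moreover have "ends H (f x) \<inter> ends H (f y) \<noteq> {}" using g[of x] g[of y] xy by auto
    ultimately have "f x = f y" using f V by (auto simp: line_graph_def bij_betw_def)
    then show "x = y" using f V by (auto simp: bij_betw_def inj_on_def)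
  qed
  moreover have "g ` S \<subseteq> ends H (f v)" using g by auto
  ultimately have "card S \<le> card (ends H (f v))" using fin card_inj_on_le by blast
  then show "card S \<le> 2" using fin by linarith
qed

section \<open>Orders on one colour class\<close>

lemma degree_le_max_degree:
  assumes "finite_simple_graph G" "v \<in> verts G"
  shows "degree G v \<le> max_degree G"
  using assms unfolding max_degree_def finite_simple_graph_def by (intro Max_ge) auto

definition nbrs_in :: "'a graph \<Rightarrow> 'a set \<Rightarrow> 'a \<Rightarrow> 'a set" where
  "nbrs_in G C v = {u \<in> C. adj G v u}"

text \<open>This is what the rays require: \<open>y\<close> lies outside the range spanned by the
  neighbours of \<open>v\<close> in \<open>C\<close>. There are at most two of them, and giving them
  different labels makes \<open>orders_separating_labels\<close> applicable.\<close>

lemma class_orders: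
  fixes G :: "'a graph"
  assumes fsg: "finite_simple_graph G" and cf: "claw_free G"
    and C: "C \<subseteq> verts G" "\<And>x y. x \<in> C \<Longrightarrow> y \<in> C \<Longrightarrow> \<not> adj G x y"
    and r: "max_degree G < 2^2^r"
  shows "\<exists>(s :: nat \<Rightarrow> 'a \<Rightarrow> nat) M. (\<forall>j<r + 2. inj_on (s j) C \<and> (\<forall>x\<in>C. s j x < M)) \<and>
    (\<forall>y\<in>C. \<forall>v\<in>verts G. \<not> adj G v y \<longrightarrow> (\<exists>j<r + 2.
      (\<forall>x\<in>nbrs_in G C v. s j y < s j x) \<or> nbrs_in G C v \<noteq> {} \<and> (\<forall>x\<in>nbrs_in G C v. s j x < s j y)))"
proof -
  have fin: "finite (verts G)" and sym: "\<And>u v. adj G u v \<Longrightarrow> adj G v u"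
    and V: "\<And>u v. adj G u v \<Longrightarrow> v \<in> verts G"
    using fsg unfolding finite_simple_graph_def by blast+
  have finC: "finite C" using C(1) fin finite_subset by blast
  have finN: "finite (nbrs_in G C v)" for v using finC by (simp add: nbrs_in_def)
  have two: "card (nbrs_in G C v) \<le> 2" if "v \<in> verts G" for v
  proof -
    have "nbrs_in G C v \<subseteq> {u \<in> verts G. adj G v u}"
      and "\<forall>x\<in>nbrs_in G C v. \<forall>y\<in>nbrs_in G C v. \<not> adj G x y"
      using C by (auto simp: nbrs_in_def)
    then show ?thesis using cf that unfolding claw_free_def by blast
  qed
  define R where "R x z \<longleftrightarrow> x \<noteq> z \<and> (\<exists>v. adj G x v \<and> adj G z v)" for x z
  have R_sym: "R x z \<Longrightarrow> R z x" and R_irrefl: "\<not> R x x" for x z by (auto simp: R_def)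
  \<comment> \<open>By claw-freeness each neighbour \<open>v\<close> of \<open>x\<close> has at most
    one further neighbour in \<open>C\<close>, so \<open>x\<close> is in conflict with at most
    \<open>degree G x\<close> members of \<open>C\<close>.\<close>
  have "card {z \<in> C. R x z} \<le> max_degree G" if x: "x \<in> C" for x
  proof -
    let ?N = "{v \<in> verts G. adj G x v}"
    have "{z \<in> C. R x z} \<subseteq> (\<Union>v\<in>?N. nbrs_in G C v - {x})"
      unfolding R_def nbrs_in_def using sym V by blast
    then have "card {z \<in> C. R x z} \<le> card (\<Union>v\<in>?N. nbrs_in G C v - {x})"
      using fin finN by (intro card_mono) auto
    also have "\<dots> \<le> (\<Sum>v\<in>?N. card (nbrs_in G C v - {x}))"
      using fin by (intro card_UN_le) auto
    also have "\<dots> \<le> (\<Sum>v\<in>?N. 1)"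
    proof (rule sum_mono)
      fix v assume v: "v \<in> ?N"
      then have "x \<in> nbrs_in G C v" using x sym by (auto simp: nbrs_in_def)
      then show "card (nbrs_in G C v - {x}) \<le> 1" using two[of v] v by (simp add: card_Diff_singleton)
    qed
    also have "\<dots> = degree G x" by (simp add: degree_def)
    also have "\<dots> \<le> max_degree G" using degree_le_max_degree[OF fsg] x C by blast
    finally show ?thesis .
  qed
  then obtain lab :: "'a \<Rightarrow> nat" where lab: "\<And>x. x \<in> C \<Longrightarrow> lab x \<le> max_degree G"
    "\<And>x z. x \<in> C \<Longrightarrow> z \<in> C \<Longrightarrow> R x z \<Longrightarrow> lab x \<noteq> lab z"
    using greedy_colouring[where V = C and R = R and d = "max_degree G"] finC R_sym R_irrefl by blast
  have "lab x < 2^2^r" if "x \<in> C" for x using lab(1)[OF that] r by linarith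
  then obtain s :: "nat \<Rightarrow> 'a \<Rightarrow> nat" and M where
    s: "\<forall>j<r + 2. inj_on (s j) C \<and> (\<forall>x\<in>C. s j x < M)" and
    sep: "\<And>x y z. x \<in> C \<Longrightarrow> y \<in> C \<Longrightarrow> z \<in> C \<Longrightarrow> y \<noteq> x \<Longrightarrow> y \<noteq> z \<Longrightarrow> x = z \<or> lab x \<noteq> lab z \<Longrightarrow>
      \<exists>j<r + 2. not_between (s j) x y z"
    using orders_separating_labels[OF finC, of lab r] by metis
  have "\<exists>j<r + 2. (\<forall>x\<in>nbrs_in G C v. s j y < s j x) \<or>
      nbrs_in G C v \<noteq> {} \<and> (\<forall>x\<in>nbrs_in G C v. s j x < s j y)"
    if y: "y \<in> C" and v: "v \<in> verts G" and na: "\<not> adj G v y" for y v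
  proof (cases "nbrs_in G C v = {}")
    case True
    then show ?thesis by auto
  next
    case False
    then have "card (nbrs_in G C v) = 1 \<or> card (nbrs_in G C v) = 2"
      using two[OF v] finN[of v] by (metis One_nat_def Suc_1 card_0_eq le_SucE le_zero_eq)
    \<comment> \<open>A single neighbour is covered by \<open>x = z\<close>.\<close>
    then obtain x z where xz: "nbrs_in G C v = {x, z}"
      by (metis card_1_singletonE card_2_iff insert_absorb2)
    then have xzC: "x \<in> C" "z \<in> C" and a: "adj G v x" "adj G v z" by (auto simp: nbrs_in_def)
    have "x = z \<or> lab x \<noteq> lab z" using lab(2)[OF xzC] a sym by (auto simp: R_def)
    moreover have "y \<noteq> x" "y \<noteq> z" using a na by auto
    ultimately obtain j where "j < r + 2" "not_between (s j) x y z" using sep xzC y by blast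
    then show ?thesis unfolding xz not_between_def by auto
  qed
  with s show ?thesis by blast
qed

section \<open>Assembling the interval graphs\<close>

lemma boxicity_claw_free:
  fixes G :: "'a graph"
  assumes fsg: "finite_simple_graph G" and cf: "claw_free G" and r: "max_degree G < 2^2^r"
  shows "boxicity G \<le> 2 * max_degree G * (r + 2) + 1"
proof -
  define d where "d = max_degree G"
  have fin: "finite (verts G)" and sym: "\<And>u v. adj G u v \<Longrightarrow> adj G v u"
    using fsg unfolding finite_simple_graph_def by blast+
  obtain col :: "'a \<Rightarrow> nat" where col: "\<And>v. v \<in> verts G \<Longrightarrow> col v \<le> d"
    "\<And>u v. adj G u v \<Longrightarrow> col u \<noteq> col v"
  proof -
    have "card {u \<in> verts G. adj G v u} \<le> d" if "v \<in> verts G" for v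
      using degree_le_max_degree[OF fsg that] by (simp add: degree_def d_def)
    then obtain col :: "'a \<Rightarrow> nat" where c: "\<forall>v\<in>verts G. col v \<le> d"
      "\<forall>u\<in>verts G. \<forall>v\<in>verts G. adj G u v \<and> u \<noteq> v \<longrightarrow> col u \<noteq> col v"
      using greedy_colouring[of "verts G" "adj G" d] fin sym by blast
    have "u \<in> verts G \<and> v \<in> verts G \<and> u \<noteq> v" if "adj G u v" for u v
      using fsg that unfolding finite_simple_graph_def by blast
    with c show ?thesis by (intro that[of col]) blast+
  qed
  define C where "C c = {v \<in> verts G. col v = c}" for c
  have C: "C c \<subseteq> verts G" "x \<in> C c \<Longrightarrow> y \<in> C c \<Longrightarrow> \<not> adj G x y" for c x y
    using col(2)[of x y] by (auto simp: C_def)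
  define N where "N c = nbrs_in G (C c)" for c
  have finN: "finite (N c v)" for c v using fin by (simp add: N_def nbrs_in_def C_def)
  have N: "x \<in> N c v \<longleftrightarrow> x \<in> C c \<and> adj G v x" for x c v by (simp add: N_def nbrs_in_def)
  have "\<forall>c. \<exists>(s :: nat \<Rightarrow> 'a \<Rightarrow> nat) M. (\<forall>j<r + 2. inj_on (s j) (C c) \<and> (\<forall>x\<in>C c. s j x < M)) \<and>
    (\<forall>y\<in>C c. \<forall>v\<in>verts G. \<not> adj G v y \<longrightarrow> (\<exists>j<r + 2.
      (\<forall>x\<in>N c v. s j y < s j x) \<or> N c v \<noteq> {} \<and> (\<forall>x\<in>N c v. s j x < s j y)))"
    unfolding N_def by (intro allI class_orders fsg cf C r)
  then obtain s :: "nat \<Rightarrow> nat \<Rightarrow> 'a \<Rightarrow> nat" and M where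
    s_inj: "\<And>c j. j < r + 2 \<Longrightarrow> inj_on (s c j) (C c)" and
    s_less: "\<And>c j x. j < r + 2 \<Longrightarrow> x \<in> C c \<Longrightarrow> s c j x < M c" and
    sep: "\<And>c y v. y \<in> C c \<Longrightarrow> v \<in> verts G \<Longrightarrow> \<not> adj G v y \<Longrightarrow> (\<exists>j<r + 2.
      (\<forall>x\<in>N c v. s c j y < s c j x) \<or> N c v \<noteq> {} \<and> (\<forall>x\<in>N c v. s c j x < s c j y))"
    by metis
  text \<open>The index \<open>None\<close> stands for the interval graph of the last colour class; the Boolean component
    of the other indices selects rays to the right or to the left.\<close>
  define I where "I = insert None (Some ` ({..<d} \<times> {..<r + 2} \<times> (UNIV :: bool set)))"
  \<comment> \<open>Rays are cut off to \<open>{0..M c}\<close>: those to the right all end at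
    \<open>M c\<close> and those to the left all start at \<open>0\<close>, so they meet pairwise.
    The inserted \<open>M c\<close> and \<open>0\<close> serve vertices without neighbours in the
    class. Under \<open>None\<close>, a vertex outside \<open>C d\<close> gets all of
    \<open>{0..M d}\<close> and meets everything.\<close>
  define lo where "lo i v = (case i of
      None \<Rightarrow> if v \<in> C d then s d 0 v else 0
    | Some (c, j, right) \<Rightarrow> if v \<in> C c then s c j v
        else if right then Min (insert (M c) (s c j ` N c v)) else 0)" for i v
  define hi where "hi i v = (case i of
      None \<Rightarrow> if v \<in> C d then s d 0 v else M d
    | Some (c, j, right) \<Rightarrow> if v \<in> C c then s c j v
        else if right then M c else Max (insert 0 (s c j ` N c v)))" for i v
  have lohi: "lo i v \<le> hi i v" for i v
    using finN by (auto simp: lo_def hi_def split: option.splits prod.splits)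
  \<comment> \<open>The other overlap inequality follows by exchanging \<open>u\<close> and
    \<open>v\<close>. Only a point against a ray needs an argument: the point is a neighbour, and
    the ray starts at the first or last neighbour.\<close>
  have meet: "lo i u \<le> hi i v" if i: "i \<in> I" and a: "adj G u v" for i u v
  proof (cases i)
    case None
    then show ?thesis using C(2) a s_less[of 0] by (auto simp: lo_def hi_def less_imp_le)
  next
    case (Some t)
    then obtain c j b where t: "i = Some (c, j, b)" "j < r + 2" using i by (cases t) (auto simp: I_def)
    show ?thesis
    proof (cases b)
      case True
      have "lo i u \<le> s c j v" if "v \<in> C c"
      proof -
        have "u \<notin> C c" using C(2) a that by blast
        moreover have "v \<in> N c u" using that a by (simp add: N)
        ultimately show ?thesis using t True finN by (auto simp: lo_def intro!: Min_le)
      qed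
      moreover have "lo i u \<le> M c"
        using t True finN s_less[OF t(2)] by (auto simp: lo_def less_imp_le)
      ultimately show ?thesis using t True by (auto simp: hi_def)
    next
      case False
      have "s c j u \<le> hi i v" if "u \<in> C c"
      proof -
        have "v \<notin> C c" using C(2) a that by blast
        moreover have "u \<in> N c v" using that a sym by (simp add: N)
        ultimately show ?thesis using t False finN by (auto simp: hi_def intro!: Max_ge)
      qed
      then show ?thesis using t False by (auto simp: lo_def)
    qed
  qed
  \<comment> \<open>The class of the vertex with the smaller colour separates the pair. If that
    colour is \<open>d\<close>, both vertices lie in \<open>C d\<close>, which is why
    \<open>None\<close> has to separate only members of \<open>C d\<close>.\<close>
  have apart: "\<exists>i\<in>I. lo i u > hi i v \<or> lo i v > hi i u"
    if uv: "u \<in> verts G" "v \<in> verts G" "u \<noteq> v" "\<not> adj G u v" and le: "col v \<le> col u" for u v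
  proof (cases "col v = d")
    case True
    then have in_d: "u \<in> C d" "v \<in> C d" using col(1) uv le by (auto simp: C_def intro: antisym)
    then have "s d 0 u \<noteq> s d 0 v" using s_inj[of 0 d] uv by (auto simp: inj_on_def)
    then show ?thesis using in_d by (auto simp: I_def lo_def hi_def)
  next
    case False
    define c where "c = col v"
    have c: "c < d" "v \<in> C c" using False col(1) uv by (auto simp: c_def C_def le_neq_implies_less)
    show ?thesis
    proof (cases "u \<in> C c")
      case True
      have "s c 0 u \<noteq> s c 0 v" using s_inj[of 0 c] True c uv by (auto simp: inj_on_def)
      moreover have "Some (c, 0, True) \<in> I" using c by (simp add: I_def)
      ultimately show ?thesis using True c
        by (intro bexI[of _ "Some (c, 0, True)"]) (auto simp: lo_def hi_def)
    next
      case u: False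
      obtain j where j: "j < r + 2" and
        "(\<forall>x\<in>N c u. s c j v < s c j x) \<or> N c u \<noteq> {} \<and> (\<forall>x\<in>N c u. s c j x < s c j v)"
        using sep[OF c(2) uv(1)] uv(4) by blast
      then consider "\<forall>x\<in>N c u. s c j v < s c j x"
        | "N c u \<noteq> {}" "\<forall>x\<in>N c u. s c j x < s c j v" by blast
      then show ?thesis
      proof cases
        case 1
        then have "lo (Some (c, j, True)) u > hi (Some (c, j, True)) v"
          using u c finN s_less[OF j] by (auto simp: lo_def hi_def)
        moreover have "Some (c, j, True) \<in> I" using c j by (simp add: I_def)
        ultimately show ?thesis by blast
      next
        case 2
        \<comment> \<open>Since \<open>N c u\<close> is non-empty, \<open>s c j v\<close> exceeds
          some position and is positive; hence it also exceeds the inserted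
          \<open>0\<close>.\<close>
        then have "lo (Some (c, j, False)) v > hi (Some (c, j, False)) u"
          using u c finN by (auto simp: lo_def hi_def)
        moreover have "Some (c, j, False) \<in> I" using c j by (simp add: I_def)
        ultimately show ?thesis by blast
      qed
    qed
  qed
  have "boxicity G \<le> card I"
  proof (rule boxicity_le_card[where a = "\<lambda>i v. real (lo i v)" and b = "\<lambda>i v. real (hi i v)"])
    fix u v assume uv: "u \<in> verts G" "v \<in> verts G" "u \<noteq> v"
    show "adj G u v \<longleftrightarrow>
      (\<forall>i\<in>I. real (lo i u) \<le> real (hi i v) \<and> real (lo i v) \<le> real (hi i u))"
    proof
      assume "adj G u v"
      then show "\<forall>i\<in>I. real (lo i u) \<le> real (hi i v) \<and> real (lo i v) \<le> real (hi i u)"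
        using meet sym by simp
    next
      assume *: "\<forall>i\<in>I. real (lo i u) \<le> real (hi i v) \<and> real (lo i v) \<le> real (hi i u)"
      show "adj G u v"
      proof (rule ccontr)
        assume na: "\<not> adj G u v"
        then have "\<exists>i\<in>I. lo i u > hi i v \<or> lo i v > hi i u"
          using apart[OF uv na] apart[of v u] uv sym by (metis nle_le)
        with * show False by force
      qed
    qed
  qed (auto simp: I_def lohi)
  \<comment> \<open>\<open>d\<close> classes, \<open>r + 2\<close> orders and two directions, plus
    \<open>None\<close>.\<close>
  also have "card I = Suc (d * ((r + 2) * 2))"
    by (simp add: I_def card_insert_if card_image card_cartesian_product image_iff)
  finally show ?thesis by (simp add: d_def algebra_simps)
qed

section \<open>The iterated logarithm\<close>

theorem theorem3:
  fixes H :: "('v, 'e) multigraph" and G :: "'a graph"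
  assumes "finite_multigraph H"
    and "finite_simple_graph G"
    and "graph_isomorphic G (line_graph H)"
  shows "real (boxicity G)
    \<le> 2 * real (max_degree G) * (real_of_int \<lceil>log 2 (log 2 (real (max_degree G)))\<rceil> + 3) + 1"
proof -
  define d where "d = max_degree G"
  define l where "l = log 2 (log 2 (real d))"
  define k where "k = nat \<lceil>l\<rceil>"
  \<comment> \<open>The choice of \<open>k\<close> gives only \<open>d \<le> 2^2^k\<close>, but
    \<open>d + 1\<close> labels must fit. The exponent \<open>k + 1\<close> makes the bound strict,
    and \<open>r = k + 1\<close> turns \<open>r + 2\<close> into \<open>k + 3\<close>.\<close>
  have "l \<ge> 0 \<and> d < 2^2^(k + 1)"
  proof (cases "d \<ge> 2")
    case True
    then have log_d: "log 2 (real d) \<ge> 1" by simp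
    then have "l \<ge> 0" by (simp add: l_def)
    then have "l \<le> real k" by (simp add: k_def)
    then have "log 2 (real d) \<le> 2 powr real k" using log_d by (simp add: l_def log_le_iff)
    then have "log 2 (real d) \<le> real (2^k)" by (simp add: powr_realpow)
    then have "real d \<le> 2 powr real (2^k)" using True by (subst (asm) log_le_iff) auto
    also have "2 powr real (2^k) = real (2^2^k)" by (subst powr_realpow) simp_all
    finally have "d \<le> 2^2^k" by (simp only: of_nat_le_iff)
    also have "\<dots> < (2::nat)^2^(k + 1)" by (intro power_strict_increasing) auto
    finally show ?thesis using \<open>l \<ge> 0\<close> by simp
  next
    case False
    then have "d = 0 \<or> d = 1" by auto
    moreover have "(1::nat) < 2^2^(k + 1)" by (intro one_less_power) auto
    \<comment> \<open>For \<open>d = 0\<close> and \<open>d = 1\<close> the convention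
      \<open>log 2 0 = 0\<close> yields \<open>l = 0\<close>.\<close>
    moreover have "log 2 0 = (0::real)" by (simp add: log_def)
    ultimately show ?thesis by (auto simp: l_def)
  qed
  then have l: "l \<ge> 0" and d: "max_degree G < 2^2^(k + 1)" by (simp_all add: d_def)
  \<comment> \<open>\<open>l \<ge> 0\<close> keeps \<open>nat\<close> from truncating the
    ceiling.\<close>
  then have k: "real_of_int \<lceil>l\<rceil> = real k" by (simp add: k_def)
  have "boxicity G \<le> 2 * d * (k + 3) + 1"
    using boxicity_claw_free[OF assms(2) claw_free_line_graph[OF assms(1,3)] d]
    by (simp add: d_def numeral_eq_Suc)
  then have "real (boxicity G) \<le> real (2 * d * (k + 3) + 1)"
    by (simp only: of_nat_le_iff)
  then show ?thesis using k by (simp add: d_def l_def)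
qed

end
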